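(* Let $\mathtt C:=\textsc{polythr}^k_d$ be the class of polynomial threshold functions of degree at most $k$ on $\{-1,1\}^d$, and let $f:\{-1,1\}^d\to\{-1,1\}$ be a function. Suppose there exists a function $g\in\mathtt C$ such that for each $h\in\mathtt C$ that differs from $g$ on exactly one input $u$, we have $g(u)=f(u)=\neg h(u)$ (call such a $g$ a "local maximum"). If $g\neq f$, then $f\notin\mathtt C$. (In other words, if $f\in\mathtt C$, then the "local maximum" $g$ must be a "global maximum", i.e. equal to $f$.)
   Context: $\textsc{polythr}^k_d$ is the set of functions $\{-1,1\}^d\to\{-1,1\}$ of the form $u\mapsto \operatorname{sgn}(p(u))$, where $p$ is a real polynomial in $d$ variables of degree at most $k$ that does not vanish at any point of $\{-1,1\}^d$. $\neg$ exchanges $1$ and $-1$.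
   Formalization: The degree bound k is assumed to be at least 1; for k = 0 and d ≥ 1 the class consists of the two constants, so g = 1 is vacuously a local maximum for f = −1 in the class and the claim fails. *)

theory Defs
  imports Complex_Main "HOL-Library.FuncSet" "HOL-Library.Poly_Mapping"
begin

text \<open>Multivariate real polynomials are finitely supported maps from monomials to coefficients;
  a monomial is a finitely supported map from variable indices to exponents.\<close>

type_synonym mpoly = "(nat \<Rightarrow>\<^sub>0 nat) \<Rightarrow>\<^sub>0 real"

definition mpoly_eval :: "mpoly \<Rightarrow> (nat \<Rightarrow> real) \<Rightarrow> real" where
  "mpoly_eval p u =
     (\<Sum>m\<in>Poly_Mapping.keys p. Poly_Mapping.lookup p m *
        (\<Prod>i\<in>Poly_Mapping.keys m. u i ^ Poly_Mapping.lookup m i))"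

definition mpoly_vars :: "mpoly \<Rightarrow> nat set" where
  "mpoly_vars p = (\<Union>m\<in>Poly_Mapping.keys p. Poly_Mapping.keys m)"

definition monom_degree :: "(nat \<Rightarrow>\<^sub>0 nat) \<Rightarrow> nat" where
  "monom_degree m = (\<Sum>i\<in>Poly_Mapping.keys m. Poly_Mapping.lookup m i)"

text \<open>Total degree; the zero polynomial gets degree 0.\<close>

definition mpoly_degree :: "mpoly \<Rightarrow> nat" where
  "mpoly_degree p = Max (insert 0 (monom_degree ` Poly_Mapping.keys p))"

definition cube :: "nat \<Rightarrow> (nat \<Rightarrow> real) set" where
  "cube d = {..<d} \<rightarrow>\<^sub>E {-1, 1}"

text \<open>Functions on the cube are represented extensionally (undefined off the cube), so that
  HOL equality of such functions is equality on the cube.\<close>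

definition bool_funs :: "nat \<Rightarrow> ((nat \<Rightarrow> real) \<Rightarrow> real) set" where
  "bool_funs d = cube d \<rightarrow>\<^sub>E {-1, 1}"

definition polythr :: "nat \<Rightarrow> nat \<Rightarrow> ((nat \<Rightarrow> real) \<Rightarrow> real) set" where
  "polythr k d = {restrict (\<lambda>u. sgn (mpoly_eval p u)) (cube d) | p.
     mpoly_vars p \<subseteq> {..<d} \<and> mpoly_degree p \<le> k \<and> (\<forall>u\<in>cube d. mpoly_eval p u \<noteq> 0)}"

text \<open>Logical negation, exchanging 1 and -1, is unary minus.\<close>

definition local_maximum ::
  "nat \<Rightarrow> ((nat \<Rightarrow> real) \<Rightarrow> real) set \<Rightarrow> ((nat \<Rightarrow> real) \<Rightarrow> real) \<Rightarrow> ((nat \<Rightarrow> real) \<Rightarrow> real) \<Rightarrow> bool" where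
  "local_maximum d C f g \<longleftrightarrow> g \<in> C \<and>
     (\<forall>h\<in>C. \<forall>u. {v\<in>cube d. h v \<noteq> g v} = {u} \<longrightarrow> g u = f u \<and> f u = - h u)"

end

theory Submission
  imports Defs
begin

text \<open>
  Think of a polynomial of degree at most \<open>k\<close> as a point of a finite-dimensional real vector
  space. The inputs \<open>u\<close> give hyperplanes (the polynomials vanishing at \<open>u\<close>), and the threshold
  functions correspond to the regions that these hyperplanes cut out. Suppose that \<open>f = sgn q\<close> and
  \<open>g = sgn p\<close> are different threshold functions. Walking from \<open>p\<close> towards \<open>q\<close>, the first hyperplanes
  that are met belong to inputs at which \<open>f\<close> and \<open>g\<close> disagree. If only one hyperplane is met at that
  moment, then crossing it gives a threshold function \<open>h\<close> that differs from \<open>g\<close> at one input \<open>u\<close>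
  only, and \<open>g u \<noteq> f u\<close>; so \<open>g\<close> is not a local maximum.

  The walk may meet a set \<open>M\<close> of several hyperplanes at once, and then the point \<open>s\<close> reached has to
  be moved so that it lies on only one of them and on the side of \<open>g\<close> of all others. This is where
  degree one is needed: \<open>exposing_polynomial\<close> picks \<open>u\<^sub>0 \<in> M\<close> minimising \<open>\<bar>q u\<bar>\<close>
  and uses the affine function \<open>1 + \<langle>u\<^sub>0, u\<rangle>\<close>. The vectors \<open>(1, u)\<close> with \<open>u\<close> in the cube all have
  the same length, so \<open>(1, u\<^sub>0) / q u\<^sub>0\<close> is a longest one among the vectors \<open>(1, u) / q u\<close>
  with \<open>u \<in> M\<close>, and by Cauchy-Schwarz the inner product with it is maximised there alone.
\<close>

section \<open>Polynomial functions of bounded degree\<close>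

definition poly_funs :: "nat \<Rightarrow> nat \<Rightarrow> ((nat \<Rightarrow> real) \<Rightarrow> real) set" where
  "poly_funs k d = {mpoly_eval p | p. mpoly_vars p \<subseteq> {..<d} \<and> mpoly_degree p \<le> k}"

lemma mpoly_degree_le_iff:
  "mpoly_degree p \<le> k \<longleftrightarrow> (\<forall>m\<in>Poly_Mapping.keys p. monom_degree m \<le> k)"
  by (simp add: mpoly_degree_def)

lemma poly_funs_iff:
  "F \<in> poly_funs k d \<longleftrightarrow> (\<exists>p. F = mpoly_eval p \<and>
     (\<forall>m\<in>Poly_Mapping.keys p. Poly_Mapping.keys m \<subseteq> {..<d} \<and> monom_degree m \<le> k))"
  unfolding poly_funs_def mpoly_degree_le_iff mpoly_vars_def by blast

text \<open>Summing over a fixed larger set of monomials makes evaluation visibly linear, although the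
  support of a sum of polynomials can shrink by cancellation.\<close>

lemma mpoly_eval_superset:
  assumes "finite A" "Poly_Mapping.keys p \<subseteq> A"
  shows "mpoly_eval p u = (\<Sum>m\<in>A. Poly_Mapping.lookup p m *
           (\<Prod>i\<in>Poly_Mapping.keys m. u i ^ Poly_Mapping.lookup m i))"
  unfolding mpoly_eval_def
  by (rule sum.mono_neutral_left) (use assms in \<open>auto simp: in_keys_iff\<close>)

lemma poly_funs_add:
  assumes "F \<in> poly_funs k d" "G \<in> poly_funs k d"
  shows "(\<lambda>u. F u + G u) \<in> poly_funs k d"
proof -
  from assms obtain p q where pq: "F = mpoly_eval p" "G = mpoly_eval q"
    and keys: "\<forall>m\<in>Poly_Mapping.keys p \<union> Poly_Mapping.keys q.
      Poly_Mapping.keys m \<subseteq> {..<d} \<and> monom_degree m \<le> k"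
    unfolding poly_funs_iff by blast
  have sub: "Poly_Mapping.keys (p + q) \<subseteq> Poly_Mapping.keys p \<union> Poly_Mapping.keys q"
    by (rule Poly_Mapping.keys_add)
  let ?A = "Poly_Mapping.keys p \<union> Poly_Mapping.keys q"
  have "F u + G u = mpoly_eval (p + q) u" for u
    using sub unfolding pq
    by (simp add: mpoly_eval_superset[of ?A] lookup_add distrib_right sum.distrib)
  then have "(\<lambda>u. F u + G u) = mpoly_eval (p + q)"
    by auto
  with keys sub show ?thesis
    unfolding poly_funs_iff by blast
qed

lemma poly_funs_scale:
  assumes "F \<in> poly_funs k d"
  shows "(\<lambda>u. c * F u) \<in> poly_funs k d"
proof -
  from assms obtain p where p: "F = mpoly_eval p"
    and keys: "\<forall>m\<in>Poly_Mapping.keys p. Poly_Mapping.keys m \<subseteq> {..<d} \<and> monom_degree m \<le> k"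
    unfolding poly_funs_iff by blast
  let ?cp = "Poly_Mapping.map ((*) c) p"
  have lookup: "Poly_Mapping.lookup ?cp m = c * Poly_Mapping.lookup p m" for m
    by (simp add: Poly_Mapping.map.rep_eq when_def)
  then have sub: "Poly_Mapping.keys ?cp \<subseteq> Poly_Mapping.keys p"
    by (auto simp: in_keys_iff)
  have "c * F u = mpoly_eval ?cp u" for u
    using sub unfolding p
    by (simp add: mpoly_eval_superset[of "Poly_Mapping.keys p"] lookup sum_distrib_left mult.assoc)
  then have "(\<lambda>u. c * F u) = mpoly_eval ?cp"
    by auto
  with keys sub show ?thesis
    unfolding poly_funs_iff by blast
qed

lemma poly_funs_const: "(\<lambda>u. c) \<in> poly_funs k d"
proof -
  have "(\<lambda>u. c) = mpoly_eval (Poly_Mapping.single 0 c)"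
    by (auto simp: mpoly_eval_def)
  then show ?thesis
    unfolding poly_funs_iff
    by (intro exI[of _ "Poly_Mapping.single 0 c"]) (auto simp: monom_degree_def split: if_splits)
qed

lemma poly_funs_var:
  assumes "i < d" "k \<ge> 1"
  shows "(\<lambda>u. u i) \<in> poly_funs k d"
proof -
  let ?x = "Poly_Mapping.single (Poly_Mapping.single i 1) 1 :: mpoly"
  have "(\<lambda>u. u i) = mpoly_eval ?x"
    by (auto simp: mpoly_eval_def)
  with assms show ?thesis
    unfolding poly_funs_iff
    by (intro exI[of _ ?x]) (auto simp: monom_degree_def split: if_splits)
qed

lemma poly_funs_sum:
  assumes "finite I" "\<And>i. i \<in> I \<Longrightarrow> F i \<in> poly_funs k d"
  shows "(\<lambda>u. \<Sum>i\<in>I. F i u) \<in> poly_funs k d"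
  using assms by (induction I rule: finite_induct) (simp_all add: poly_funs_const poly_funs_add)

lemma poly_funs_affine:
  assumes "k \<ge> 1"
  shows "(\<lambda>u. c + (\<Sum>i<d. w i * u i)) \<in> poly_funs k d"
  by (intro poly_funs_add poly_funs_const poly_funs_sum poly_funs_scale poly_funs_var)
     (use assms in auto)

lemma polythr_iff:
  "h \<in> polythr k d \<longleftrightarrow>
     (\<exists>F\<in>poly_funs k d. (\<forall>u\<in>cube d. F u \<noteq> 0) \<and> h = restrict (\<lambda>u. sgn (F u)) (cube d))"
  unfolding polythr_def poly_funs_def by auto

section \<open>Exposing a single input\<close>

lemma finite_cube: "finite (cube d)"
  unfolding cube_def by (intro finite_PiE) auto

lemma cube_mult_self:
  assumes "u \<in> cube d" "i < d"
  shows "u i * u i = 1"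
  using assms unfolding cube_def by (auto dest!: PiE_mem[of u _ _ i])

text \<open>The case of equality in Cauchy-Schwarz for the vectors \<open>(1, u)\<close> and \<open>(1, v)\<close>. The common
  first coordinate \<open>1\<close> keeps these vectors from being antipodal, so the absolute value is covered
  as well.\<close>

lemma cube_inner_less:
  assumes u: "u \<in> cube d" and v: "v \<in> cube d" and "u \<noteq> v"
  shows "\<bar>1 + (\<Sum>i<d. u i * v i)\<bar> < real d + 1"
proof -
  have entry: "\<bar>u i * v i\<bar> = 1" if "i < d" for i
    using that u v unfolding cube_def by (auto dest!: PiE_mem[of _ _ _ i])
  from u v \<open>u \<noteq> v\<close> obtain j where j: "j < d" "u j \<noteq> v j"
    unfolding cube_def by (metis PiE_ext lessThan_iff)
  then have "u j * v j < 1"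
    using u v unfolding cube_def by (auto dest!: PiE_mem[of _ _ _ j])
  then have "(\<Sum>i<d. u i * v i) < (\<Sum>i<d. 1)"
    using j entry by (intro sum_strict_mono_ex1) (auto simp: abs_le_iff intro: order.trans[OF abs_ge_self])
  moreover have "(\<Sum>i<d. - 1) \<le> (\<Sum>i<d. u i * v i)"
    using entry by (intro sum_mono) (metis abs_ge_minus_self lessThan_iff minus_le_iff)
  ultimately show ?thesis
    by auto
qed

text \<open>The witness is \<open>\<plusminus>(1 + \<langle>u\<^sub>0, u\<rangle>) - c * q u\<close> with \<open>c\<close> and the sign chosen so that it vanishes at
  \<open>u\<^sub>0\<close>. At another point of \<open>M\<close> the affine part is smaller in absolute value than \<open>d + 1\<close>, while
  \<open>c * q u\<close> is at least \<open>d + 1\<close> because \<open>\<bar>q\<bar>\<close> is smallest at \<open>u\<^sub>0\<close>; hence the second term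
  decides the sign.\<close>

lemma exposing_polynomial:
  assumes "k \<ge> 1" and q: "q \<in> poly_funs k d"
    and M: "M \<subseteq> cube d" "M \<noteq> {}" and q_nz: "\<And>u. u \<in> M \<Longrightarrow> q u \<noteq> 0"
  obtains r u0 where "r \<in> poly_funs k d" "u0 \<in> M" "r u0 = 0"
    and "\<And>u. u \<in> M - {u0} \<Longrightarrow> sgn (r u) = - sgn (q u)"
proof -
  have "finite M"
    using M(1) finite_cube by (rule finite_subset)
  then obtain u0 where u0: "u0 \<in> M" and min: "\<And>u. u \<in> M \<Longrightarrow> \<bar>q u0\<bar> \<le> \<bar>q u\<bar>"
    using ex_is_arg_min_if_finite[of M "\<lambda>u. \<bar>q u\<bar>"] M(2)
    by (auto simp: is_arg_min_def not_less)
  define l where "l = (\<lambda>u. sgn (q u0) * (1 + (\<Sum>i<d. u0 i * u i)))"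
  define c where "c = (real d + 1) / \<bar>q u0\<bar>"
  define r where "r = (\<lambda>u. l u + (- c) * q u)"
  have "q u0 \<noteq> 0"
    using u0 q_nz by blast
  then have "c > 0"
    by (simp add: c_def)
  have "r \<in> poly_funs k d"
    unfolding r_def l_def using \<open>k \<ge> 1\<close> q by (intro poly_funs_add poly_funs_scale poly_funs_affine)
  moreover have "r u0 = 0"
  proof -
    have "u0 \<in> cube d"
      using u0 M(1) by blast
    then have "(\<Sum>i<d. u0 i * u0 i) = real d"
      by (simp add: cube_mult_self)
    then show ?thesis
      using \<open>q u0 \<noteq> 0\<close> by (simp add: r_def l_def c_def sgn_real_def field_simps)
  qed
  moreover have "sgn (r u) = - sgn (q u)" if u: "u \<in> M - {u0}" for u
  proof -
    have "\<bar>l u\<bar> < real d + 1"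
      using cube_inner_less[of u0 d u] u u0 M(1) \<open>q u0 \<noteq> 0\<close>
      by (auto simp: l_def abs_mult)
    also have "\<dots> = c * \<bar>q u0\<bar>"
      using \<open>q u0 \<noteq> 0\<close> by (simp add: c_def)
    also have "\<dots> \<le> c * \<bar>q u\<bar>"
      using min u \<open>c > 0\<close> by simp
    finally have lt: "\<bar>l u\<bar> < c * \<bar>q u\<bar>" .
    show ?thesis
    proof (cases "q u > 0")
      case True
      with lt show ?thesis by (simp add: r_def sgn_real_def abs_less_iff)
    next
      case False
      with lt q_nz[of u] u show ?thesis by (simp add: r_def sgn_real_def abs_less_iff)
    qed
  qed
  ultimately show ?thesis
    using u0 that by blast
qed

section \<open>Crossing one wall\<close>

lemma small_perturbation:
  fixes s r :: "'a \<Rightarrow> real"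
  assumes "finite X"
  obtains e where "e > 0"
    and "\<And>u. u \<in> X \<Longrightarrow> s u \<noteq> 0 \<Longrightarrow> sgn (s u + e * r u) = sgn (s u)"
    and "\<And>u. s u = 0 \<Longrightarrow> sgn (s u + e * r u) = sgn (r u)"
proof -
  have "\<forall>\<^sub>F e in at_right 0. e * \<bar>r u\<bar> < \<bar>s u\<bar>" if "s u \<noteq> 0" for u
  proof -
    have "((\<lambda>e. e * \<bar>r u\<bar>) \<longlongrightarrow> 0 * \<bar>r u\<bar>) (at_right 0)"
      by (intro tendsto_intros)
    then show ?thesis
      using that by (auto dest: order_tendstoD(2)[of _ _ _ "\<bar>s u\<bar>"])
  qed
  then have "\<forall>\<^sub>F e in at_right 0. \<forall>u\<in>X. s u \<noteq> 0 \<longrightarrow> e * \<bar>r u\<bar> < \<bar>s u\<bar>"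
    using assms by (intro eventually_ball_finite) (auto simp: eventually_mono)
  then have "\<forall>\<^sub>F e in at_right 0. e > 0 \<and> (\<forall>u\<in>X. s u \<noteq> 0 \<longrightarrow> e * \<bar>r u\<bar> < \<bar>s u\<bar>)"
    by (intro eventually_conj eventually_at_right_less)
  then obtain e :: real where "e > 0"
    and small: "\<And>u. u \<in> X \<Longrightarrow> s u \<noteq> 0 \<Longrightarrow> e * \<bar>r u\<bar> < \<bar>s u\<bar>"
    using eventually_happens'[of "at_right (0::real)"] trivial_limit_at_right_real by blast
  have "sgn (s u + e * r u) = sgn (s u)" if "u \<in> X" "s u \<noteq> 0" for u
  proof -
    have "\<bar>e * r u\<bar> < \<bar>s u\<bar>"
      using small[OF that] \<open>e > 0\<close> by (simp add: abs_mult)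
    then show ?thesis
      by (auto simp: sgn_real_def)
  qed
  moreover have "sgn (s u + e * r u) = sgn (r u)" if "s u = 0" for u
    using that \<open>e > 0\<close> by (simp add: sgn_mult)
  ultimately show ?thesis
    using \<open>e > 0\<close> that by blast
qed

text \<open>The first crossing of the walk from \<open>p\<close> to \<open>q\<close>, in the scale \<open>p + t * q\<close> with \<open>t \<ge> 0\<close>. An input
  \<open>u\<close> where the signs disagree is crossed at time \<open>\<bar>p u\<bar> / \<bar>q u\<bar>\<close>, one where they agree is never
  crossed.\<close>

lemma first_crossing:
  fixes p q :: "'a \<Rightarrow> real"
  assumes "finite X" "\<And>u. u \<in> X \<Longrightarrow> p u \<noteq> 0" "\<And>u. u \<in> X \<Longrightarrow> q u \<noteq> 0"
    and "\<exists>u\<in>X. sgn (p u) \<noteq> sgn (q u)"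
  obtains t where "t > 0" "\<exists>u\<in>X. p u + t * q u = 0"
    and "\<And>u. u \<in> X \<Longrightarrow> p u + t * q u \<noteq> 0 \<Longrightarrow> sgn (p u + t * q u) = sgn (p u)"
    and "\<And>u. u \<in> X \<Longrightarrow> p u + t * q u = 0 \<Longrightarrow> sgn (p u) = - sgn (q u)"
proof -
  define D where "D = {u\<in>X. sgn (p u) \<noteq> sgn (q u)}"
  have D: "finite D" "D \<noteq> {}"
    using assms unfolding D_def by auto
  obtain w where w: "w \<in> D"
    and min: "\<And>u. u \<in> D \<Longrightarrow> \<bar>p w\<bar> / \<bar>q w\<bar> \<le> \<bar>p u\<bar> / \<bar>q u\<bar>"
    using ex_is_arg_min_if_finite[of D "\<lambda>u. \<bar>p u\<bar> / \<bar>q u\<bar>"] D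
    by (auto simp: is_arg_min_def not_less)
  define t where "t = \<bar>p w\<bar> / \<bar>q w\<bar>"
  have wX: "w \<in> X" "p w \<noteq> 0" "q w \<noteq> 0"
    using w assms by (auto simp: D_def)
  then have "t > 0"
    by (simp add: t_def)
  have "p w + t * q w = 0"
    using w wX by (auto simp: D_def t_def sgn_real_def split: if_splits)
  moreover have "sgn (p u + t * q u) = sgn (p u)" if u: "u \<in> X" and nz: "p u + t * q u \<noteq> 0" for u
  proof (cases "u \<in> D")
    case True
    then have "t * \<bar>q u\<bar> \<le> \<bar>p u\<bar>"
      using min[of u] assms(3)[OF u] by (simp add: t_def le_divide_eq)
    with True nz u assms(2,3)[OF u] show ?thesis
      by (auto simp: D_def sgn_real_def split: if_splits)
  next
    case False
    then have "sgn (p u) = sgn (t * q u)"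
      using u \<open>t > 0\<close> by (simp add: D_def sgn_mult)
    then show ?thesis
      using assms(2)[OF u] by (auto simp: sgn_real_def split: if_splits)
  qed
  moreover have "sgn (p u) = - sgn (q u)" if "u \<in> X" "p u + t * q u = 0" for u
  proof -
    have "p u = - (t * q u)"
      using that by linarith
    then show ?thesis
      using \<open>t > 0\<close> by (simp add: sgn_minus sgn_mult)
  qed
  ultimately show ?thesis
    using \<open>t > 0\<close> wX(1) that by blast
qed

text \<open>In the language of regions: a region other than that of \<open>q\<close> has a wall that separates
  it from the region of \<open>q\<close>. The first perturbation moves the point \<open>s\<close> of the first crossing into the
  relative interior of a single wall, the second crosses that wall.\<close>

lemma separating_wall:
  assumes "k \<ge> 1" and p: "p \<in> poly_funs k d" and q: "q \<in> poly_funs k d"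
    and p_nz: "\<And>u. u \<in> cube d \<Longrightarrow> p u \<noteq> 0" and q_nz: "\<And>u. u \<in> cube d \<Longrightarrow> q u \<noteq> 0"
    and differ: "\<exists>u\<in>cube d. sgn (p u) \<noteq> sgn (q u)"
  obtains p' u0 where "p' \<in> poly_funs k d" "u0 \<in> cube d"
    and "sgn (p' u0) = sgn (q u0)" "sgn (p u0) = - sgn (q u0)"
    and "\<And>u. u \<in> cube d - {u0} \<Longrightarrow> sgn (p' u) = sgn (p u)"
proof -
  obtain t where "t > 0" and hit: "\<exists>u\<in>cube d. p u + t * q u = 0"
    and before: "\<And>u. u \<in> cube d \<Longrightarrow> p u + t * q u \<noteq> 0 \<Longrightarrow> sgn (p u + t * q u) = sgn (p u)"
    and opposite: "\<And>u. u \<in> cube d \<Longrightarrow> p u + t * q u = 0 \<Longrightarrow> sgn (p u) = - sgn (q u)"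
    using first_crossing[OF finite_cube p_nz q_nz differ] by blast
  define s where "s = (\<lambda>u. p u + t * q u)"
  define M where "M = {u\<in>cube d. s u = 0}"
  have M: "M \<subseteq> cube d" "M \<noteq> {}" "\<And>u. u \<in> M \<Longrightarrow> q u \<noteq> 0"
    using hit q_nz by (auto simp: M_def s_def)
  obtain r u0 where r: "r \<in> poly_funs k d" and u0: "u0 \<in> M" "r u0 = 0"
    and sgn_r: "\<And>u. u \<in> M - {u0} \<Longrightarrow> sgn (r u) = - sgn (q u)"
    using exposing_polynomial[OF \<open>k \<ge> 1\<close> q M] by blast
  obtain e where s_stable: "\<And>u. u \<in> cube d \<Longrightarrow> s u \<noteq> 0 \<Longrightarrow> sgn (s u + e * r u) = sgn (s u)"
    and s_zero: "\<And>u. s u = 0 \<Longrightarrow> sgn (s u + e * r u) = sgn (r u)"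
    using small_perturbation[OF finite_cube[of d], of s r] by blast
  define s' where "s' = (\<lambda>u. s u + e * r u)"
  have s'_u0: "s' u0 = 0"
    using u0 by (simp add: s'_def M_def)
  have s'_else: "sgn (s' u) = sgn (p u)" if u: "u \<in> cube d - {u0}" for u
  proof (cases "s u = 0")
    case True
    then show ?thesis
      using u s_zero[of u] sgn_r[of u] opposite[of u] by (auto simp: s'_def M_def s_def)
  next
    case False
    then show ?thesis
      using u s_stable[of u] before[of u] by (auto simp: s'_def s_def)
  qed
  obtain e' where s'_stable: "\<And>u. u \<in> cube d \<Longrightarrow> s' u \<noteq> 0 \<Longrightarrow> sgn (s' u + e' * q u) = sgn (s' u)"
    and s'_zero: "\<And>u. s' u = 0 \<Longrightarrow> sgn (s' u + e' * q u) = sgn (q u)"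
    using small_perturbation[OF finite_cube[of d], of s' q] by blast
  define p' where "p' = (\<lambda>u. s' u + e' * q u)"
  have "p' \<in> poly_funs k d"
    unfolding p'_def s'_def s_def using p q r by (intro poly_funs_add poly_funs_scale)
  moreover have "sgn (p' u0) = sgn (q u0)"
    using s'_zero[OF s'_u0] by (simp add: p'_def)
  moreover have "sgn (p u0) = - sgn (q u0)"
    using u0(1) opposite[of u0] by (simp add: M_def s_def)
  moreover have "sgn (p' u) = sgn (p u)" if u: "u \<in> cube d - {u0}" for u
  proof -
    have "s' u \<noteq> 0"
      using s'_else[OF u] p_nz[of u] u by (metis DiffD1 sgn_eq_0_iff)
    then show ?thesis
      using u s'_stable[of u] s'_else[OF u] by (simp add: p'_def)
  qed
  ultimately show ?thesis
    using u0(1) M(1) that by blast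
qed

section \<open>Local maxima are global\<close>

theorem theorem1p2:
  fixes d k :: nat and f g :: "(nat \<Rightarrow> real) \<Rightarrow> real"
  assumes "k \<ge> 1"
    and "f \<in> bool_funs d"
    and "local_maximum d (polythr k d) f g"
    and "g \<noteq> f"
  shows "f \<notin> polythr k d"
proof
  assume "f \<in> polythr k d"
  then obtain q where q: "q \<in> poly_funs k d" "\<And>u. u \<in> cube d \<Longrightarrow> q u \<noteq> 0"
    and f: "f = restrict (\<lambda>u. sgn (q u)) (cube d)"
    unfolding polythr_iff by blast
  have "g \<in> polythr k d"
    using assms(3) by (simp add: local_maximum_def)
  then obtain p where p: "p \<in> poly_funs k d" "\<And>u. u \<in> cube d \<Longrightarrow> p u \<noteq> 0"
    and g: "g = restrict (\<lambda>u. sgn (p u)) (cube d)"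
    unfolding polythr_iff by blast
  have "\<exists>u\<in>cube d. sgn (p u) \<noteq> sgn (q u)"
    using \<open>g \<noteq> f\<close> unfolding f g by (metis restrict_ext)
  then obtain p' u0 where p': "p' \<in> poly_funs k d" and u0: "u0 \<in> cube d"
    and at_u0: "sgn (p' u0) = sgn (q u0)" "sgn (p u0) = - sgn (q u0)"
    and else: "\<And>u. u \<in> cube d - {u0} \<Longrightarrow> sgn (p' u) = sgn (p u)"
    using separating_wall[OF \<open>k \<ge> 1\<close> p(1) q(1) p(2) q(2)] by blast
  define h where "h = restrict (\<lambda>u. sgn (p' u)) (cube d)"
  have "p' u \<noteq> 0" if "u \<in> cube d" for u
    using that at_u0(1) else[of u] p(2)[of u] q(2)[of u]
    by (metis Diff_iff sgn_eq_0_iff singletonD)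
  then have "h \<in> polythr k d"
    unfolding polythr_iff h_def using p' by blast
  moreover have gf: "g u0 \<noteq> f u0"
    using u0 at_u0(2) q(2)[OF u0] by (simp add: f g sgn_real_def split: if_splits)
  moreover have "{v\<in>cube d. h v \<noteq> g v} = {u0}"
    using u0 at_u0 else gf by (auto simp: h_def f g)
  ultimately show False
    using assms(3) unfolding local_maximum_def by blast
qed

end
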